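(* Let $R$ be a right Ore domain. (i) If $R$ is a division ring, then $$\mu_{\mathrm{C4}}(R)=\mu_{\mathrm{C4}^*}(R)=\mu_{\text{semi-weak-CS}}(R)=\mu_{\text{strong }\mathrm{C4}^*}(R)=\mathbb N_{\ge1}.$$ (ii) If $R$ is not a division ring, then $$\mu_{\mathrm{C4}}(R)=\mu_{\mathrm{C4}^*}(R)=\mu_{\text{strong }\mathrm{C4}^*}(R)=\{1\},\qquad \mu_{\text{semi-weak-CS}}(R)=\mathbb N_{\ge1}.$$
   Context: All rings are associative with identity and all modules are unitary right modules. A right Ore domain is a (not necessarily commutative) domain $R$ with $aR\cap bR\ne0$ for all nonzero $a,b\in R$. For a module property $\mathcal Q$, the matrix profile is $\mu_{\mathcal Q}(R)=\{n\ge1:R_R^n\text{ has }\mathcal Q\}$; it is used here for the properties C4, C4$^*$, semi-weak-CS and strongly C4$^*$ (written "strong C4$^*$" as a subscript). A module $M$ is a C4-module if, whenever $M=A\oplus B$ (internal direct sum) and $f:A\to B$ is a homomorphism such that $\ker f$ is a direct summand of $A$, the image $\operatorname{Im} f$ is a direct summand of $B$. A module is C4$^*$ if every submodule of it is a C4-module. For a module $M$, $\mathcal S(M)$ is the set of triples $(X,Y,\varphi)$ where $X,Y$ are semisimple direct summands of $M$ with $X\cap Y=0$ and $\varphi:X\to Y$ is an isomorphism. It is partially ordered by $(X,Y,\varphi)\preccurlyeq(X',Y',\varphi')$ iff $X\le X'$, $Y\le Y'$ and $\varphi'|_X=\varphi$. For a chain $\mathcal C\subseteq\mathcal S(M)$,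 put $X_{\mathcal C}=\bigcup_{(X,Y,\varphi)\in\mathcal C}X$ and $Y_{\mathcal C}=\bigcup_{(X,Y,\varphi)\in\mathcal C}Y$. The module $M$ is semi-weak-CS if for every chain $\mathcal C\subseteq\mathcal S(M)$ there are direct summands $A,B$ of $M$ such that $X_{\mathcal C}$ is an essential submodule of $A$ and $Y_{\mathcal C}$ is an essential submodule of $B$. A module is strongly C4$^*$ if it is both C4$^*$ and semi-weak-CS. *)

theory Defs
  imports Main "HOL-Library.FuncSet" "HOL-Library.Function_Algebras"
begin

(* Right modules over a not necessarily commutative ring.  As in HOL.Modules, the ring and the
   ambient module are types; the modules under consideration are submodules of the ambient one,
   given as sets.  This loses no generality, since UNIV is a submodule. *)
locale right_module =
  fixes scale :: "'m::ab_group_add \<Rightarrow> 'r::ring_1 \<Rightarrow> 'm" (infixl \<open>\<cdot>\<close> 75)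
  assumes scale_left_distrib: "(x + y) \<cdot> a = x \<cdot> a + y \<cdot> a"
    and scale_right_distrib: "x \<cdot> (a + b) = x \<cdot> a + x \<cdot> b"
    and scale_scale: "x \<cdot> a \<cdot> b = x \<cdot> (a * b)"
    and scale_one: "x \<cdot> 1 = x"
begin

definition submodule :: "'m set \<Rightarrow> bool" where
  "submodule N \<longleftrightarrow>
     0 \<in> N \<and> (\<forall>x\<in>N. \<forall>y\<in>N. x + y \<in> N) \<and> (\<forall>x\<in>N. \<forall>a. x \<cdot> a \<in> N)"

definition direct_sum :: "'m set \<Rightarrow> 'm set \<Rightarrow> 'm set \<Rightarrow> bool" where
  "direct_sum M A B \<longleftrightarrow>
     submodule A \<and> submodule B \<and> A \<inter> B = {0} \<and> M = {a + b | a b. a \<in> A \<and> b \<in> B}"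

definition direct_summand :: "'m set \<Rightarrow> 'm set \<Rightarrow> bool" where
  "direct_summand A M \<longleftrightarrow> (\<exists>B. direct_sum M A B)"

(* Only the values of f on A matter. *)
definition module_hom_on :: "'m set \<Rightarrow> 'm set \<Rightarrow> ('m \<Rightarrow> 'm) \<Rightarrow> bool" where
  "module_hom_on A B f \<longleftrightarrow>
     f \<in> A \<rightarrow> B \<and> (\<forall>x\<in>A. \<forall>y\<in>A. f (x + y) = f x + f y) \<and> (\<forall>x\<in>A. \<forall>a. f (x \<cdot> a) = f x \<cdot> a)"

definition module_iso_on :: "'m set \<Rightarrow> 'm set \<Rightarrow> ('m \<Rightarrow> 'm) \<Rightarrow> bool" where
  "module_iso_on A B f \<longleftrightarrow> module_hom_on A B f \<and> bij_betw f A B"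

definition kernel_on :: "'m set \<Rightarrow> ('m \<Rightarrow> 'm) \<Rightarrow> 'm set" where
  "kernel_on A f = {x \<in> A. f x = 0}"

definition essential_submodule :: "'m set \<Rightarrow> 'm set \<Rightarrow> bool" where
  "essential_submodule N M \<longleftrightarrow>
     submodule N \<and> N \<subseteq> M \<and> (\<forall>K. submodule K \<and> K \<subseteq> M \<and> K \<noteq> {0} \<longrightarrow> N \<inter> K \<noteq> {0})"

definition semisimple :: "'m set \<Rightarrow> bool" where
  "semisimple M \<longleftrightarrow> (\<forall>N. submodule N \<and> N \<subseteq> M \<longrightarrow> direct_summand N M)"

definition C4_module :: "'m set \<Rightarrow> bool" where
  "C4_module M \<longleftrightarrow>
     (\<forall>A B f. direct_sum M A B \<and> module_hom_on A B f \<and> direct_summand (kernel_on A f) A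
        \<longrightarrow> direct_summand (f ` A) B)"

definition C4_star_module :: "'m set \<Rightarrow> bool" where
  "C4_star_module M \<longleftrightarrow> (\<forall>N. submodule N \<and> N \<subseteq> M \<longrightarrow> C4_module N)"

(* A map on X is represented by its extension by undefined, so that distinct elements of
   summand_isos M are distinct triples and triple_le is antisymmetric. *)
definition summand_isos :: "'m set \<Rightarrow> ('m set \<times> 'm set \<times> ('m \<Rightarrow> 'm)) set" where
  "summand_isos M =
     {(X, Y, \<phi>). direct_summand X M \<and> direct_summand Y M \<and> semisimple X \<and> semisimple Y \<and>
        X \<inter> Y = {0} \<and> module_iso_on X Y \<phi> \<and> \<phi> \<in> extensional X}"

definition triple_le ::
    "'m set \<times> 'm set \<times> ('m \<Rightarrow> 'm) \<Rightarrow> 'm set \<times> 'm set \<times> ('m \<Rightarrow> 'm) \<Rightarrow> bool" where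
  "triple_le = (\<lambda>(X, Y, \<phi>) (X', Y', \<phi>'). X \<subseteq> X' \<and> Y \<subseteq> Y' \<and> restrict \<phi>' X = \<phi>)"

(* The empty chain is excluded because its set-theoretic unions would be the empty set, which is
   not a submodule.  Reading its unions as the zero submodule instead gives the same notion. *)
definition semi_weak_CS :: "'m set \<Rightarrow> bool" where
  "semi_weak_CS M \<longleftrightarrow>
     (\<forall>C. C \<subseteq> summand_isos M \<and> C \<noteq> {} \<and> Complete_Partial_Order.chain triple_le C \<longrightarrow>
        (\<exists>A B. direct_summand A M \<and> direct_summand B M \<and>
           essential_submodule (\<Union>(X, Y, \<phi>)\<in>C. X) A \<and>
           essential_submodule (\<Union>(X, Y, \<phi>)\<in>C. Y) B))"

definition strongly_C4_star_module :: "'m set \<Rightarrow> bool" where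
  "strongly_C4_star_module M \<longleftrightarrow> C4_star_module M \<and> semi_weak_CS M"

end

(* The free right module of rank n consists of the functions on nat supported in {..<n}. *)
definition vec_scale :: "(nat \<Rightarrow> 'r::ring_1) \<Rightarrow> 'r \<Rightarrow> (nat \<Rightarrow> 'r)" where
  "vec_scale v a = (\<lambda>i. v i * a)"

definition free_module :: "nat \<Rightarrow> (nat \<Rightarrow> 'r::ring_1) set" where
  "free_module n = {v. \<forall>i\<ge>n. v i = 0}"

interpretation free: right_module vec_scale
  by unfold_locales (simp_all add: vec_scale_def fun_eq_iff algebra_simps)

lemma submodule_free_module: "free.submodule (free_module n)"
  by (simp add: free.submodule_def free_module_def vec_scale_def)

(* A module property takes the scalar multiplication of the ambient module and the module. *)
definition matrix_profile ::
    "'r::ring_1 itself \<Rightarrow> (((nat \<Rightarrow> 'r) \<Rightarrow> 'r \<Rightarrow> (nat \<Rightarrow> 'r)) \<Rightarrow> (nat \<Rightarrow> 'r) set \<Rightarrow> bool) \<Rightarrow> nat set"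
  where "matrix_profile _ Q = {n. n \<ge> 1 \<and> Q vec_scale (free_module n)}"

(* Being a domain is expressed by the type class ring_1_no_zero_divisors, which does not assume
   commutativity; only the Ore condition remains. *)
definition right_Ore_domain :: "'r::ring_1_no_zero_divisors itself \<Rightarrow> bool" where
  "right_Ore_domain _ \<longleftrightarrow>
     (\<forall>a b :: 'r. a \<noteq> 0 \<and> b \<noteq> 0 \<longrightarrow> range (\<lambda>r. a * r) \<inter> range (\<lambda>r. b * r) \<noteq> {0})"

definition is_division_ring :: "'r::ring_1 itself \<Rightarrow> bool" where
  "is_division_ring _ \<longleftrightarrow> (\<forall>a :: 'r. a \<noteq> 0 \<longrightarrow> (\<exists>b. a * b = 1 \<and> b * a = 1))"

end

theory Submission
  imports Defs
begin

text \<open>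
  Over a division ring every submodule is a direct summand, so all four properties hold trivially.
  Otherwise let \<open>c\<close> be a nonzero nonunit.  If \<open>M = xcR \<oplus> K\<close> contains a torsion-free \<open>x\<close> and
  \<open>x = xcr + k\<close> with \<open>k \<in> K\<close>, then \<open>kc = xc(1 - rc)\<close> lies in \<open>xcR \<inter> K = 0\<close>, which forces \<open>cr = 1\<close>.
  Hence \<open>xcR\<close> is never a summand of \<open>M\<close>.  Consequently the only semisimple submodule of \<open>R\<^sup>n\<close> is \<open>0\<close>,
  which gives semi-weak-CS, and for \<open>n \<ge> 2\<close> the monomorphism \<open>e\<^sub>0r \<mapsto> e\<^sub>1cr\<close> violates C4.
  For \<open>n = 1\<close> the Ore condition makes every right ideal indecomposable.
\<close>

section \<open>Submodules, direct sums and summands\<close>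

context right_module
begin

lemma scale_zero_left [simp]: "0 \<cdot> a = 0"
  using scale_left_distrib[of 0 0 a] by simp

lemma scale_zero_right [simp]: "x \<cdot> 0 = 0"
  using scale_right_distrib[of x 0 0] by simp

lemma scale_minus_right: "x \<cdot> (- a) = - (x \<cdot> a)"
  using scale_right_distrib[of x a "- a"] by (simp add: eq_neg_iff_add_eq_0 add.commute)

lemma scale_diff_right: "x \<cdot> (a - b) = x \<cdot> a - x \<cdot> b"
  using scale_right_distrib[of x a "- b"] by (simp add: scale_minus_right)

lemma submodule_uminus:
  assumes "submodule N" "x \<in> N"
  shows "- x \<in> N"
proof -
  have "x \<cdot> (- 1) \<in> N"
    using assms unfolding submodule_def by blast
  then show ?thesis by (simp add: scale_minus_right scale_one)
qed

lemma submodule_zero: "submodule {0}"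
  by (simp add: submodule_def)

lemma submodule_range_scale: "submodule (range (\<lambda>a. x \<cdot> a))"
  unfolding submodule_def
proof (intro conjI ballI allI)
  show "0 \<in> range (\<lambda>a. x \<cdot> a)"
    by (rule range_eqI[of _ _ 0]) simp
next
  fix y z assume "y \<in> range (\<lambda>a. x \<cdot> a)" "z \<in> range (\<lambda>a. x \<cdot> a)"
  then show "y + z \<in> range (\<lambda>a. x \<cdot> a)"
    by (auto simp flip: scale_right_distrib)
next
  fix y b assume "y \<in> range (\<lambda>a. x \<cdot> a)"
  then show "y \<cdot> b \<in> range (\<lambda>a. x \<cdot> a)"
    by (auto simp: scale_scale)
qed

text \<open>Two elements of the union lie in a common member by comparability, and nonemptiness
  supplies \<open>0\<close>. This serves both the Zorn argument and the unions over chains of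
  triples.\<close>

lemma submodule_Union_chain:
  assumes "\<And>N. N \<in> S \<Longrightarrow> submodule N" "S \<noteq> {}"
    and "\<And>N K. N \<in> S \<Longrightarrow> K \<in> S \<Longrightarrow> N \<subseteq> K \<or> K \<subseteq> N"
  shows "submodule (\<Union>S)"
  unfolding submodule_def
proof (intro conjI ballI allI)
  show "0 \<in> \<Union>S"
    using assms(1,2) by (auto simp: submodule_def)
next
  fix x y assume "x \<in> \<Union>S" "y \<in> \<Union>S"
  then obtain N where "N \<in> S" "x \<in> N" "y \<in> N"
    using assms(3) by blast
  then show "x + y \<in> \<Union>S"
    using assms(1)[of N] by (auto simp: submodule_def)
next
  fix x a assume "x \<in> \<Union>S"
  then show "x \<cdot> a \<in> \<Union>S"
    using assms(1) unfolding submodule_def by blast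
qed

lemma direct_sumE:
  assumes "direct_sum M A B" "x \<in> M"
  obtains a b where "a \<in> A" "b \<in> B" "x = a + b"
  using assms by (auto simp: direct_sum_def)

lemma direct_summand_submodule: "direct_summand A M \<Longrightarrow> submodule A"
  by (auto simp: direct_summand_def direct_sum_def)

lemma direct_summand_subset:
  assumes "direct_summand A M"
  shows "A \<subseteq> M"
proof
  fix a assume a: "a \<in> A"
  obtain B where M: "M = {a + b | a b. a \<in> A \<and> b \<in> B}" and "0 \<in> B"
    using assms by (auto simp: direct_summand_def direct_sum_def submodule_def)
  then have "a + 0 \<in> M" using a by blast
  then show "a \<in> M" by simp
qed

lemma direct_summand_zero:
  assumes "submodule M"
  shows "direct_summand {0} M"
proof -
  have "direct_sum M {0} M"
    using assms by (auto simp: direct_sum_def submodule_zero submodule_def)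
  then show ?thesis
    by (auto simp: direct_summand_def)
qed

lemma module_hom_on_zero:
  assumes "module_hom_on A B f" "submodule A"
  shows "f 0 = 0"
proof -
  have "0 \<in> A" using assms(2) by (simp add: submodule_def)
  then have "f (0 + 0) = f 0 + f 0"
    using assms(1) unfolding module_hom_on_def by blast
  then show ?thesis by simp
qed

lemma essential_submodule_refl: "submodule N \<Longrightarrow> essential_submodule N N"
  by (auto simp: essential_submodule_def Int_absorb1)

section \<open>Modules over a division ring\<close>

text \<open>Zorn's lemma gives a submodule \<open>K\<close> of \<open>M\<close> maximal with
  \<open>N \<inter> K = {0}\<close>. If some \<open>m\<close> in \<open>M\<close> lay outside
  \<open>N + K\<close>, adjoining it to \<open>K\<close> would keep the intersection with
  \<open>N\<close> zero, since nonzero scalars can be inverted; this contradicts maximality.\<close>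

lemma direct_summand_if_division_ring:
  assumes div: "is_division_ring TYPE('r)"
    and N: "submodule N" "N \<subseteq> M" and M: "submodule M"
  shows "direct_summand N M"
proof -
  define S where "S = {K. submodule K \<and> K \<subseteq> M \<and> N \<inter> K = {0}}"
  have "\<exists>K\<in>S. \<forall>L\<in>S. K \<subseteq> L \<longrightarrow> L = K"
  proof (rule subset_Zorn_nonempty)
    have "{0} \<in> S"
      using N M by (auto simp: S_def submodule_zero submodule_def)
    then show "S \<noteq> {}" by blast
  next
    fix C assume C: "C \<noteq> {}" "subset.chain S C"
    have "submodule (\<Union>C)"
      using C by (intro submodule_Union_chain) (auto simp: S_def subset_chain_def)
    moreover have "\<Union>C \<subseteq> M" "N \<inter> \<Union>C = {0}"
      using C by (fastforce simp: S_def subset_chain_def)+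
    ultimately show "\<Union>C \<in> S"
      by (simp add: S_def)
  qed
  then obtain K where K: "submodule K" "K \<subseteq> M" "N \<inter> K = {0}"
    and max: "\<And>L. L \<in> S \<Longrightarrow> K \<subseteq> L \<Longrightarrow> L = K"
    by (auto simp: S_def)
  have "m \<in> {a + b | a b. a \<in> N \<and> b \<in> K}" if m: "m \<in> M" for m
  proof (rule ccontr)
    assume notin: "m \<notin> {a + b | a b. a \<in> N \<and> b \<in> K}"
    \<comment> \<open>\<open>L\<close> is \<open>K\<close> enlarged by the cyclic submodule
      generated by \<open>m\<close>.\<close>
    define L where "L = {k + m \<cdot> a | k a. k \<in> K}"
    have LI: "k + m \<cdot> a \<in> L" if "k \<in> K" for k a
      using that by (auto simp: L_def)
    have "submodule L"
      unfolding submodule_def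
    proof (intro conjI ballI allI)
      show "0 \<in> L"
        using LI[of 0 0] K(1) by (simp add: submodule_def)
    next
      fix x y assume "x \<in> L" "y \<in> L"
      then obtain k a l b where "x = k + m \<cdot> a" "y = l + m \<cdot> b" "k \<in> K" "l \<in> K"
        by (auto simp: L_def)
      then show "x + y \<in> L"
        using LI[of "k + l" "a + b"] K(1)
        by (simp add: submodule_def scale_right_distrib algebra_simps)
    next
      fix x b assume "x \<in> L"
      then obtain k a where "x = k + m \<cdot> a" "k \<in> K"
        by (auto simp: L_def)
      then show "x \<cdot> b \<in> L"
        using LI[of "k \<cdot> b" "a * b"] K(1)
        by (simp add: submodule_def scale_left_distrib scale_scale)
    qed
    moreover have "L \<subseteq> M"
      using K(2) m M by (auto simp: L_def submodule_def)
    moreover have "x = 0" if x: "x \<in> N" "x \<in> L" for x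
    proof -
      obtain k a where ka: "x = k + m \<cdot> a" "k \<in> K"
        using x(2) by (auto simp: L_def)
      show ?thesis
      proof (cases "a = 0")
        case True
        then show ?thesis using ka x(1) K(3) by auto
      next
        case False
        then obtain b where b: "a * b = 1"
          using div by (auto simp: is_division_ring_def)
        \<comment> \<open>Inverting the coefficient of \<open>m\<close> solves for \<open>m\<close>
          and places it in \<open>N + K\<close>.\<close>
        have "x \<cdot> b = k \<cdot> b + m"
          by (simp add: ka scale_left_distrib scale_scale scale_one b)
        then have "m = x \<cdot> b + - (k \<cdot> b)"
          by (simp add: algebra_simps)
        moreover have "x \<cdot> b \<in> N" "- (k \<cdot> b) \<in> K"
          using x(1) ka(2) N(1) K(1) submodule_uminus by (auto simp: submodule_def)
        ultimately show ?thesis using notin by blast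
      qed
    qed
    ultimately have "L \<in> S"
      using N(1) by (auto simp: S_def submodule_def)
    moreover have "K \<subseteq> L"
      using LI[of _ 0] by auto
    ultimately have "L = K" by (rule max)
    moreover have "m \<in> L"
      using LI[of 0 1] K(1) by (simp add: scale_one submodule_def)
    ultimately have "0 + m \<in> {a + b | a b. a \<in> N \<and> b \<in> K}"
      using N(1) by (auto simp only: submodule_def)
    then show False using notin by simp
  qed
  moreover have "a + b \<in> M" if "a \<in> N" "b \<in> K" for a b
    using that N(2) K(2) M by (auto simp: submodule_def)
  ultimately have "direct_sum M N K"
    using N K by (auto simp: direct_sum_def)
  then show ?thesis by (auto simp: direct_summand_def)
qed

text \<open>The image of a homomorphism is a submodule of \<open>B\<close>, and over a division ring
  every submodule of \<open>B\<close> is a summand.\<close>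

lemma C4_module_if_division_ring:
  assumes "is_division_ring TYPE('r)"
  shows "C4_module M"
  unfolding C4_module_def
proof (intro allI impI, elim conjE)
  fix A B f
  assume dec: "direct_sum M A B" and hom: "module_hom_on A B f"
  then have AB: "submodule A" "submodule B"
    by (auto simp: direct_sum_def)
  have add: "x \<in> A \<Longrightarrow> y \<in> A \<Longrightarrow> f x + f y = f (x + y)"
    and scale: "x \<in> A \<Longrightarrow> f x \<cdot> a = f (x \<cdot> a)" and B: "x \<in> A \<Longrightarrow> f x \<in> B" for x y a
    using hom by (auto simp: module_hom_on_def)
  have "submodule (f ` A)"
    unfolding submodule_def
  proof (intro conjI ballI allI)
    show "0 \<in> f ` A"
      using module_hom_on_zero[OF hom AB(1)] AB(1) by (force simp: submodule_def)
  next
    fix u v assume "u \<in> f ` A" "v \<in> f ` A"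
    then show "u + v \<in> f ` A"
      using AB(1) by (auto simp: add submodule_def)
  next
    fix u a assume "u \<in> f ` A"
    then show "u \<cdot> a \<in> f ` A"
      using AB(1) by (auto simp: scale submodule_def)
  qed
  moreover have "f ` A \<subseteq> B"
    using B by blast
  ultimately show "direct_summand (f ` A) B"
    using direct_summand_if_division_ring[OF assms] AB(2) by blast
qed

text \<open>The unions over the chain are themselves submodules of \<open>M\<close>, hence summands,
  so they can serve as \<open>A\<close> and \<open>B\<close>.\<close>

lemma semi_weak_CS_if_division_ring:
  assumes div: "is_division_ring TYPE('r)" and M: "submodule M"
  shows "semi_weak_CS M"
  unfolding semi_weak_CS_def
proof (intro allI impI, elim conjE)
  fix C
  assume C: "C \<subseteq> summand_isos M" "C \<noteq> {}" "Complete_Partial_Order.chain triple_le C"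
  \<comment> \<open>Here \<open>g\<close> stands for either projection of a triple, to
    \<open>X\<close> or to \<open>Y\<close>, so one argument treats both unions; monotonicity turns
    the chain of triples into a chain of submodules.\<close>
  have *: "direct_summand (\<Union>(g ` C)) M \<and> essential_submodule (\<Union>(g ` C)) (\<Union>(g ` C))"
    if g: "\<And>t. t \<in> C \<Longrightarrow> direct_summand (g t) M"
      and mono: "\<And>s t. triple_le s t \<Longrightarrow> g s \<subseteq> g t" for g
  proof -
    have "submodule (\<Union>(g ` C))"
    proof (rule submodule_Union_chain)
      fix N K assume "N \<in> g ` C" "K \<in> g ` C"
      then obtain s t where "s \<in> C" "N = g s" "t \<in> C" "K = g t"
        by blast
      moreover from this have "triple_le s t \<or> triple_le t s"
        using C(3) by (simp add: chain_def)
      ultimately show "N \<subseteq> K \<or> K \<subseteq> N"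
        using mono by blast
    qed (use C(2) g direct_summand_submodule in blast)+
    moreover have "\<Union>(g ` C) \<subseteq> M"
      using g direct_summand_subset by blast
    ultimately show ?thesis
      using direct_summand_if_division_ring[OF div] M essential_submodule_refl by blast
  qed
  have "direct_summand (\<Union>(X, Y, \<phi>)\<in>C. X) M \<and>
      essential_submodule (\<Union>(X, Y, \<phi>)\<in>C. X) (\<Union>(X, Y, \<phi>)\<in>C. X)"
    by (rule *) (use C(1) in \<open>auto simp: summand_isos_def triple_le_def\<close>)
  moreover have "direct_summand (\<Union>(X, Y, \<phi>)\<in>C. Y) M \<and>
      essential_submodule (\<Union>(X, Y, \<phi>)\<in>C. Y) (\<Union>(X, Y, \<phi>)\<in>C. Y)"
    by (rule *) (use C(1) in \<open>auto simp: summand_isos_def triple_le_def\<close>)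
  ultimately show "\<exists>A B. direct_summand A M \<and> direct_summand B M \<and>
      essential_submodule (\<Union>(X, Y, \<phi>)\<in>C. X) A \<and> essential_submodule (\<Union>(X, Y, \<phi>)\<in>C. Y) B"
    by blast
qed

section \<open>An obstruction to being a summand, and criteria for semi-weak-CS and C4\<close>

text \<open>Absence of zero divisors enters only as \<open>torsion_free\<close> for the one vector
  \<open>x\<close> and \<open>cancel\<close> for the one scalar \<open>c\<close>, so the argument
  fits any right module.\<close>

lemma direct_summand_range_scale_imp_right_inverse:
  assumes summand: "direct_summand (range (\<lambda>a. x \<cdot> (c * a))) M" and x: "x \<in> M"
    and torsion_free: "\<And>a. x \<cdot> a = 0 \<Longrightarrow> a = 0"
    and cancel: "\<And>a. a * c = 0 \<Longrightarrow> a = 0"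
  shows "\<exists>r. c * r = 1"
proof -
  let ?N = "range (\<lambda>a. x \<cdot> (c * a))"
  obtain K where K: "direct_sum M ?N K"
    using summand by (auto simp: direct_summand_def)
  obtain n k where "n \<in> ?N" "k \<in> K" "x = n + k"
    using direct_sumE[OF K x] .
  then obtain r where r: "k \<in> K" "x = x \<cdot> (c * r) + k"
    by blast
  have "k = x - x \<cdot> (c * r)"
    using r(2) by (metis add_diff_cancel_left')
  then have k: "k = x \<cdot> (1 - c * r)"
    by (simp add: scale_diff_right scale_one)
  \<comment> \<open>The identity \<open>(1 - c * r) * c = c * (1 - r * c)\<close> moves
    \<open>k \<cdot> c\<close> into \<open>?N\<close>.\<close>
  have "k \<cdot> c = x \<cdot> (c * (1 - r * c))"
    by (simp add: k scale_scale algebra_simps)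
  then have "k \<cdot> c \<in> ?N" by blast
  moreover have "k \<cdot> c \<in> K"
    using r(1) K by (auto simp: direct_sum_def submodule_def)
  ultimately have "k \<cdot> c = 0"
    using K unfolding direct_sum_def by blast
  then have "(1 - c * r) * c = 0"
    by (intro torsion_free) (simp add: k scale_scale)
  then show ?thesis
    using cancel by (metis eq_iff_diff_eq_0)
qed

text \<open>Both modules of every triple are zero, so both unions are \<open>{0}\<close>, and
  \<open>A = B = {0}\<close> works.\<close>

lemma semi_weak_CS_if_semisimple_trivial:
  assumes M: "submodule M"
    and triv: "\<And>X. submodule X \<Longrightarrow> X \<subseteq> M \<Longrightarrow> semisimple X \<Longrightarrow> X = {0}"
  shows "semi_weak_CS M"
  unfolding semi_weak_CS_def
proof (intro allI impI, elim conjE)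
  fix C assume C: "C \<subseteq> summand_isos M" "C \<noteq> {}"
  have "X = {0} \<and> Y = {0}" if "(X, Y, \<phi>) \<in> C" for X Y \<phi>
  proof -
    have "(X, Y, \<phi>) \<in> summand_isos M"
      using C(1) that by blast
    then show ?thesis
      unfolding summand_isos_def
      using triv direct_summand_submodule direct_summand_subset by blast
  qed
  \<comment> \<open>Nonemptiness of \<open>C\<close> makes the images equal to \<open>{{0}}\<close>
    rather than empty.\<close>
  then have "(\<lambda>(X, Y, \<phi>). X) ` C = {{0}}" "(\<lambda>(X, Y, \<phi>). Y) ` C = {{0}}"
    using C(2) by force+
  then have "(\<Union>(X, Y, \<phi>)\<in>C. X) = {0}" "(\<Union>(X, Y, \<phi>)\<in>C. Y) = {0}"
    by simp_all
  then show "\<exists>A B. direct_summand A M \<and> direct_summand B M \<and>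
      essential_submodule (\<Union>(X, Y, \<phi>)\<in>C. X) A \<and> essential_submodule (\<Union>(X, Y, \<phi>)\<in>C. Y) B"
    using direct_summand_zero[OF M] essential_submodule_refl[OF submodule_zero] by auto
qed

text \<open>If \<open>A = {0}\<close> the image is \<open>{f 0}\<close>, and if
  \<open>B = {0}\<close> it lies in \<open>B\<close>; either way it is the zero submodule, which is
  a summand of \<open>B\<close>.\<close>

lemma C4_module_if_indecomposable:
  assumes "\<And>A B. direct_sum M A B \<Longrightarrow> A = {0} \<or> B = {0}"
  shows "C4_module M"
  unfolding C4_module_def
proof (intro allI impI, elim conjE)
  fix A B f
  assume dec: "direct_sum M A B" and hom: "module_hom_on A B f"
  then have AB: "submodule A" "submodule B"
    by (auto simp: direct_sum_def)
  have "f 0 = 0"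
    using module_hom_on_zero[OF hom AB(1)] .
  moreover have "0 \<in> A" "f ` A \<subseteq> B"
    using AB(1) hom by (auto simp: submodule_def module_hom_on_def)
  ultimately have "0 \<in> f ` A" by (metis imageI)
  moreover have "f ` A \<subseteq> {0}"
    using assms[OF dec] \<open>f 0 = 0\<close> \<open>f ` A \<subseteq> B\<close> by auto
  ultimately have "f ` A = {0}" by blast
  then show "direct_summand (f ` A) B"
    using direct_summand_zero[OF AB(2)] by simp
qed

end

section \<open>Free modules over a domain\<close>

text \<open>In \<open>c * (r * c - 1) = (c * r) * c - c = 0\<close> the factor \<open>c\<close> can
  be cancelled. This upgrades a one-sided inverse to the two-sided one of
  \<open>is_division_ring\<close>.\<close>

lemma unit_if_right_inverse:
  fixes c r :: "'r::ring_1_no_zero_divisors"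
  assumes "c * r = 1"
  shows "r * c = 1"
proof -
  have "c * (r * c - 1) = 0"
    using assms by (simp add: right_diff_distrib flip: mult.assoc)
  moreover have "c \<noteq> 0"
    using assms by auto
  ultimately show ?thesis by simp
qed

lemma vec_scale_eq_0_iff:
  fixes x :: "nat \<Rightarrow> 'r::ring_1_no_zero_divisors"
  shows "vec_scale x a = 0 \<longleftrightarrow> x = 0 \<or> a = 0"
  by (auto simp: vec_scale_def fun_eq_iff)

text \<open>Over a domain \<open>x\<close> is torsion-free and \<open>c\<close> cancels on the
  right, so a complement would give \<open>c\<close> a right inverse, which would be
  two-sided.\<close>

lemma not_direct_summand_vec_scale_nonunit:
  fixes x :: "nat \<Rightarrow> 'r::ring_1_no_zero_divisors"
  assumes "c \<noteq> 0" "\<nexists>b. c * b = 1 \<and> b * c = 1" "x \<noteq> 0" "x \<in> M"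
  shows "\<not> free.direct_summand (range (\<lambda>a. vec_scale x (c * a))) M"
  using free.direct_summand_range_scale_imp_right_inverse[of x c M] assms unit_if_right_inverse
  by (auto simp: vec_scale_eq_0_iff)

text \<open>For nonzero \<open>x\<close> in a semisimple \<open>X\<close>, the submodule
  \<open>?N\<close> would be a summand of \<open>X\<close>; the obstruction is applied inside
  \<open>X\<close>, not inside the free module.\<close>

lemma semi_weak_CS_free_module:
  assumes "\<not> is_division_ring TYPE('r::ring_1_no_zero_divisors)"
  shows "free.semi_weak_CS (free_module n :: (nat \<Rightarrow> 'r) set)"
proof (rule free.semi_weak_CS_if_semisimple_trivial[OF submodule_free_module])
  fix X :: "(nat \<Rightarrow> 'r) set"
  assume X: "free.submodule X" "free.semisimple X"
  obtain c :: 'r where c: "c \<noteq> 0" "\<nexists>b. c * b = 1 \<and> b * c = 1"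
    using assms by (auto simp: is_division_ring_def)
  have "x = 0" if x: "x \<in> X" for x
  proof (rule ccontr)
    assume "x \<noteq> 0"
    let ?N = "range (\<lambda>a. vec_scale x (c * a))"
    \<comment> \<open>\<open>?N\<close> is the cyclic submodule generated by the vector
      \<open>vec_scale x c\<close>.\<close>
    have "free.submodule ?N"
      using free.submodule_range_scale[of "vec_scale x c"] by (simp add: free.scale_scale)
    moreover have "?N \<subseteq> X"
      using X(1) x by (auto simp: free.submodule_def)
    ultimately have "free.direct_summand ?N X"
      using X(2) by (simp add: free.semisimple_def)
    then show False
      using not_direct_summand_vec_scale_nonunit[OF c \<open>x \<noteq> 0\<close> x] by simp
  qed
  then show "X = {0}"
    using X(1) by (auto simp: free.submodule_def)
qed

text \<open>\<open>A\<close> is the line of the first unit vector and \<open>B\<close> the span of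
  the others. The injective \<open>f\<close> maps \<open>A\<close> onto the cyclic submodule
  generated by \<open>vec_scale e c\<close>, which has no complement in \<open>B\<close>.\<close>

lemma not_C4_module_free_module:
  assumes "\<not> is_division_ring TYPE('r::ring_1_no_zero_divisors)" and n: "n \<ge> 2"
  shows "\<not> free.C4_module (free_module n :: (nat \<Rightarrow> 'r) set)"
proof
  assume C4: "free.C4_module (free_module n :: (nat \<Rightarrow> 'r) set)"
  obtain c :: 'r where c: "c \<noteq> 0" "\<nexists>b. c * b = 1 \<and> b * c = 1"
    using assms(1) by (auto simp: is_division_ring_def)
  define A :: "(nat \<Rightarrow> 'r) set" where "A = {v. \<forall>i>0. v i = 0}"
  define B :: "(nat \<Rightarrow> 'r) set" where "B = {v. v 0 = 0 \<and> (\<forall>i\<ge>n. v i = 0)}"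
  \<comment> \<open>Left multiplication by \<open>c\<close> commutes with the right scalar action,
    so \<open>f\<close> is linear; coordinate 1 lies below \<open>n\<close>, so the values are in
    \<open>B\<close>.\<close>
  define f :: "(nat \<Rightarrow> 'r) \<Rightarrow> nat \<Rightarrow> 'r" where "f v = (\<lambda>i. if i = 1 then c * v 0 else 0)" for v
  define e :: "nat \<Rightarrow> 'r" where "e = (\<lambda>i. if i = 1 then 1 else 0)"
  have AB: "free.submodule A" "free.submodule B"
    by (auto simp: free.submodule_def A_def B_def vec_scale_def)
  have eq_0: "v = 0 \<longleftrightarrow> v 0 = 0" if "v \<in> A" for v
    using that by (auto simp: A_def fun_eq_iff) (metis gr0I)
  have "v \<in> {a + b | a b. a \<in> A \<and> b \<in> B} \<longleftrightarrow> v \<in> free_module n" for v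
  proof
    assume "v \<in> {a + b | a b. a \<in> A \<and> b \<in> B}"
    then show "v \<in> free_module n"
      using n by (auto simp: A_def B_def free_module_def)
  next
    assume "v \<in> free_module n"
    then have "v = (\<lambda>i. if i = 0 then v 0 else 0) + v(0 := 0)"
      "(\<lambda>i. if i = 0 then v 0 else 0) \<in> A" "v(0 := 0) \<in> B"
      by (auto simp: A_def B_def free_module_def fun_eq_iff)
    then show "v \<in> {a + b | a b. a \<in> A \<and> b \<in> B}"
      by blast
  qed
  moreover have "A \<inter> B = {0}"
    using eq_0 AB by (auto simp: B_def free.submodule_def)
  ultimately have dec: "free.direct_sum (free_module n) A B"
    using AB by (auto simp: free.direct_sum_def)
  have hom: "free.module_hom_on A B f"
    using n by (auto simp: free.module_hom_on_def B_def f_def vec_scale_def fun_eq_iff algebra_simps)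
  \<comment> \<open>Elements of \<open>A\<close> are determined by coordinate 0, and
    \<open>c\<close> is nonzero in a domain.\<close>
  have "free.kernel_on A f = {0}"
    using AB(1) c(1) eq_0 by (auto simp: free.kernel_on_def f_def free.submodule_def fun_eq_iff)
  then have "free.direct_summand (free.kernel_on A f) A"
    using free.direct_summand_zero[OF AB(1)] by simp
  then have "free.direct_summand (f ` A) B"
    using C4 dec hom unfolding free.C4_module_def by blast
  moreover have "f ` A = range (\<lambda>a. vec_scale e (c * a))"
  proof -
    have "f = (\<lambda>v. vec_scale e (c * v 0))"
      by (auto simp: f_def e_def vec_scale_def fun_eq_iff)
    then have "f ` A = (\<lambda>a. vec_scale e (c * a)) ` (\<lambda>v. v 0) ` A"
      by (simp add: image_image)
    moreover have "(\<lambda>v. v 0) ` A = UNIV"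
    proof -
      have "a \<in> (\<lambda>v. v 0) ` A" for a
        by (rule image_eqI[of _ _ "\<lambda>i. if i = 0 then a else 0"]) (auto simp: A_def)
      then show ?thesis by blast
    qed
    ultimately show ?thesis by simp
  qed
  moreover have "e \<noteq> 0" "e \<in> B"
    using n by (auto simp: e_def B_def fun_eq_iff)
  ultimately show False
    using not_direct_summand_vec_scale_nonunit[OF c] by simp
qed

text \<open>If both summands of a submodule \<open>N\<close> had nonzero elements, the Ore condition
  would give their coordinates a nonzero common right multiple, hence a nonzero vector in both
  summands. So \<open>N\<close> is indecomposable.\<close>

lemma C4_star_module_free_module_1:
  assumes Ore: "right_Ore_domain TYPE('r::ring_1_no_zero_divisors)"
  shows "free.C4_star_module (free_module 1 :: (nat \<Rightarrow> 'r) set)"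
  unfolding free.C4_star_module_def
proof (intro allI impI, elim conjE)
  fix N :: "(nat \<Rightarrow> 'r) set"
  assume N: "N \<subseteq> free_module 1"
  have eqI: "u = v" if "u \<in> free_module 1" "v \<in> free_module 1" "u 0 = v 0" for u v :: "nat \<Rightarrow> 'r"
  proof
    show "u i = v i" for i
      using that by (cases i) (auto simp: free_module_def)
  qed
  show "free.C4_module N"
  proof (rule free.C4_module_if_indecomposable, rule ccontr)
    fix A B assume dec: "free.direct_sum N A B" and "\<not> (A = {0} \<or> B = {0})"
    then have AB: "free.submodule A" "free.submodule B" "A \<inter> B = {0}" "A \<noteq> {0}" "B \<noteq> {0}"
      by (auto simp: free.direct_sum_def)
    \<comment> \<open>\<open>direct_summand_subset\<close> concerns the first summand only; swapping
      the sum covers \<open>B\<close> too.\<close>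
    have "{a + b | a b. a \<in> A \<and> b \<in> B} = {b + a | b a. b \<in> B \<and> a \<in> A}"
      by (metis (no_types, lifting) add.commute)
    then have "free.direct_sum N B A"
      using dec by (simp add: free.direct_sum_def Int_commute)
    then have "A \<subseteq> free_module 1" "B \<subseteq> free_module 1"
      using dec N free.direct_summand_subset unfolding free.direct_summand_def by blast+
    moreover obtain u v where uv: "u \<in> A" "v \<in> B" "u \<noteq> 0" "v \<noteq> 0"
      using AB unfolding free.submodule_def by blast
    ultimately have mem: "u \<in> free_module 1" "v \<in> free_module 1"
      by auto
    have 0: "(0 :: nat \<Rightarrow> 'r) \<in> free_module 1"
      by (simp add: free_module_def)
    have "u 0 \<noteq> 0" "v 0 \<noteq> 0"
      using eqI[OF mem(1) 0] eqI[OF mem(2) 0] uv by auto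
    then have "range (\<lambda>r. u 0 * r) \<inter> range (\<lambda>r. v 0 * r) \<noteq> {0}"
      using Ore by (simp add: right_Ore_domain_def)
    \<comment> \<open>As \<open>0\<close> is always in the intersection, differing from
      \<open>{0}\<close> means containing a nonzero common multiple.\<close>
    moreover have "0 \<in> range (\<lambda>r. u 0 * r) \<inter> range (\<lambda>r. v 0 * r)"
      by (auto intro: range_eqI[of _ _ 0])
    ultimately obtain r s where rs: "u 0 * r = v 0 * s" "u 0 * r \<noteq> 0"
      by fastforce
    have "vec_scale u r = vec_scale v s"
    proof
      show "vec_scale u r i = vec_scale v s i" for i
        using mem rs(1) by (cases i) (auto simp: free_module_def vec_scale_def)
    qed
    moreover have "vec_scale u r \<in> A" "vec_scale v s \<in> B"
      using AB uv by (auto simp: free.submodule_def)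
    ultimately have "vec_scale u r = 0"
      using AB(3) by auto
    then show False
      using rs(2) by (auto simp: vec_scale_def fun_eq_iff)
  qed
qed

section \<open>Computation of the matrix profiles\<close>

theorem theorem7p5:
  assumes "right_Ore_domain TYPE('r::ring_1_no_zero_divisors)"
  shows
    "(is_division_ring TYPE('r) \<longrightarrow>
        matrix_profile TYPE('r) right_module.C4_module = {1..} \<and>
        matrix_profile TYPE('r) right_module.C4_star_module = {1..} \<and>
        matrix_profile TYPE('r) right_module.semi_weak_CS = {1..} \<and>
        matrix_profile TYPE('r) right_module.strongly_C4_star_module = {1..}) \<and>
     (\<not> is_division_ring TYPE('r) \<longrightarrow>
        matrix_profile TYPE('r) right_module.C4_module = {1} \<and>
        matrix_profile TYPE('r) right_module.C4_star_module = {1} \<and>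
        matrix_profile TYPE('r) right_module.strongly_C4_star_module = {1} \<and>
        matrix_profile TYPE('r) right_module.semi_weak_CS = {1..})"
proof (intro conjI impI)
  let ?F = "free_module :: nat \<Rightarrow> (nat \<Rightarrow> 'r) set"
  note defs = matrix_profile_def free.strongly_C4_star_module_def
  \<comment> \<open>The module is a submodule of itself; hence failure of C4 also excludes
    \<open>C4_star_module\<close>.\<close>
  have C4: "free.C4_module (?F n)" if "free.C4_star_module (?F n)" for n
    using that submodule_free_module by (auto simp: free.C4_star_module_def)
  {
    assume div: "is_division_ring TYPE('r)"
    have star: "free.C4_star_module (?F n)" for n
      using free.C4_module_if_division_ring[OF div] by (simp add: free.C4_star_module_def)
    have CS: "free.semi_weak_CS (?F n)" for n
      using free.semi_weak_CS_if_division_ring[OF div submodule_free_module] .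
    show "matrix_profile TYPE('r) right_module.C4_module = {1..}"
      "matrix_profile TYPE('r) right_module.C4_star_module = {1..}"
      "matrix_profile TYPE('r) right_module.semi_weak_CS = {1..}"
      "matrix_profile TYPE('r) right_module.strongly_C4_star_module = {1..}"
      by (auto simp: defs star CS C4)
  next
    assume ndiv: "\<not> is_division_ring TYPE('r)"
    have only_1: "n \<ge> 1 \<and> P n \<longleftrightarrow> n = 1"
      if "P 1" "\<And>m. m \<ge> 2 \<Longrightarrow> \<not> P m" for P :: "nat \<Rightarrow> bool" and n
    proof
      assume n: "n \<ge> 1 \<and> P n"
      then have "\<not> n \<ge> 2" using that(2) by blast
      with n show "n = 1" by simp
    qed (use that(1) in simp)
    note star_1 = C4_star_module_free_module_1[OF assms] and not_C4 = not_C4_module_free_module[OF ndiv]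
    have C4_iff: "n \<ge> 1 \<and> free.C4_module (?F n) \<longleftrightarrow> n = 1" for n
      by (rule only_1[of "\<lambda>n. free.C4_module (?F n)", OF C4[OF star_1] not_C4])
    have star_iff: "n \<ge> 1 \<and> free.C4_star_module (?F n) \<longleftrightarrow> n = 1" for n
      by (rule only_1[of "\<lambda>n. free.C4_star_module (?F n)", OF star_1]) (use C4 not_C4 in blast)
    have CS: "free.semi_weak_CS (?F n)" for n
      using semi_weak_CS_free_module[OF ndiv] .
    show "matrix_profile TYPE('r) right_module.C4_module = {1}"
      "matrix_profile TYPE('r) right_module.C4_star_module = {1}"
      "matrix_profile TYPE('r) right_module.strongly_C4_star_module = {1}"
      "matrix_profile TYPE('r) right_module.semi_weak_CS = {1..}"
      \<comment> \<open>Since \<open>CS\<close> holds in every rank, the strong profile coincides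
        with that of \<open>C4_star_module\<close>.\<close>
      by (simp_all only: defs CS C4_iff star_iff simp_thms singleton_conv atLeast_def)
  }
qed

end
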